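(* Let $N\ge1$. For any $\Delta t>0$ and $\mathbf v\in\mathbb R^N_0$, there exists a unique $\mathbf w\in\mathbb R^N_0$ such that $\mathbf w=\mathbf v+\Delta t\,\mathbf b(\mathbf w)$.
   Context: $\mathbb N^*=\{1,2,\dots\}$. Assumptions: $\nu>0$. The function $A:\mathbb R\to\mathbb R$ is $C^2$, $A''$ is locally Lipschitz, and there are $\mathsf C_A>0$, $\mathsf p_A\in\mathbb N^*$ with $|A'(v)|\le\mathsf C_A(1+|v|^{\mathsf p_A})$ for all $v\in\mathbb R$. The function $\overline A:\mathbb R^2\to\mathbb R$ is $C^1$, its partial derivatives are locally Lipschitz on $\mathbb R^2$, and: $\overline A(v,v)=A(v)$ for all $v$; $\partial_1\overline A(v,w)\ge0$ and $\partial_2\overline A(v,w)\le0$ for all $v,w$; there are $\mathsf C_{\bar A}>0$, $\mathsf p_{\bar A}\in\mathbb N^*$ with $|\partial_1\overline A(v,w)|\le\mathsf C_{\bar A}(1+|v|^{\mathsf p_{\bar A}})$ and $|\partial_2\overline A(v,w)|\le\mathsf C_{\bar A}(1+|w|^{\mathsf p_{\bar A}})$ for all $v,w\in\mathbb R$. $\mathbb T_N=\mathbb Z/N\mathbb Z$ (identified with $\{1,\dots,N\}$, indices modulo $N$), $\mathbb R^N_0=\{\mathbf v\in\mathbb R^N:v_1+\dots+v_N=0\}$. $(\mathbf D^{(1,+)}_N\mathbf v)_i=N(v_{i+1}-v_i)$, $(\mathbf D^{(1,-)}_N\mathbf v)_i=N(v_i-v_{i-1})$, $\mathbf D^{(2)}_N=\mathbf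 D^{(1,-)}_N\mathbf D^{(1,+)}_N$. $\overline{\mathbf A}^N(\mathbf v)$ is the vector with coordinates $\overline A(v_i,v_{i+1})$, $i\in\mathbb T_N$, and $\mathbf b(\mathbf v)=-\mathbf D^{(1,-)}_N\overline{\mathbf A}^N(\mathbf v)+\nu\mathbf D^{(2)}_N\mathbf v$. *)

theory Defs
  imports "HOL-Analysis.Lipschitz" "Jordan_Normal_Form.Matrix"
begin

no_notation Finite_Cartesian_Product.vec_nth (infixl "$" 90)

definition locally_lipschitz :: "('a::metric_space \<Rightarrow> 'b::metric_space) \<Rightarrow> bool" where
  "locally_lipschitz f \<longleftrightarrow> (\<forall>x. \<exists>r>0. \<exists>L. L-lipschitz_on (cball x r) f)"

definition C2_real :: "(real \<Rightarrow> real) \<Rightarrow> bool" where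
  "C2_real f \<longleftrightarrow> (\<forall>x. f differentiable (at x)) \<and> (\<forall>x. deriv f differentiable (at x))
     \<and> continuous_on UNIV (deriv (deriv f))"

definition partial1 :: "(real \<Rightarrow> real \<Rightarrow> real) \<Rightarrow> real \<Rightarrow> real \<Rightarrow> real" where
  "partial1 F v w = deriv (\<lambda>x. F x w) v"

definition partial2 :: "(real \<Rightarrow> real \<Rightarrow> real) \<Rightarrow> real \<Rightarrow> real \<Rightarrow> real" where
  "partial2 F v w = deriv (\<lambda>y. F v y) w"

definition C1_real2 :: "(real \<Rightarrow> real \<Rightarrow> real) \<Rightarrow> bool" where
  "C1_real2 F \<longleftrightarrow> (\<forall>p. (\<lambda>(v, w). F v w) differentiable (at p))
     \<and> continuous_on UNIV (\<lambda>(v, w). partial1 F v w)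
     \<and> continuous_on UNIV (\<lambda>(v, w). partial2 F v w)"

text \<open>Vectors indexed by \<open>\<int>/N\<int>\<close> are elements of \<open>carrier_vec N\<close>. Each residue class is
  represented by its element of \<open>{0..<N}\<close>, so the class of \<open>N\<close> has index \<open>0\<close>. The predecessor
  of \<open>i\<close> is written \<open>(i + N - 1) mod N\<close> because subtraction on \<open>nat\<close> truncates.\<close>

definition zero_sum_vec :: "nat \<Rightarrow> real vec set" where
  "zero_sum_vec N = {v \<in> carrier_vec N. (\<Sum>i<N. v $ i) = 0}"

definition D1_plus :: "nat \<Rightarrow> real vec \<Rightarrow> real vec" where
  "D1_plus N v = vec N (\<lambda>i. real N * (v $ ((i + 1) mod N) - v $ i))"

definition D1_minus :: "nat \<Rightarrow> real vec \<Rightarrow> real vec" where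
  "D1_minus N v = vec N (\<lambda>i. real N * (v $ i - v $ ((i + N - 1) mod N)))"

definition D2 :: "nat \<Rightarrow> real vec \<Rightarrow> real vec" where
  "D2 N v = D1_minus N (D1_plus N v)"

definition flux_vec :: "(real \<Rightarrow> real \<Rightarrow> real) \<Rightarrow> nat \<Rightarrow> real vec \<Rightarrow> real vec" where
  "flux_vec Abar N v = vec N (\<lambda>i. Abar (v $ i) (v $ ((i + 1) mod N)))"

definition drift :: "(real \<Rightarrow> real \<Rightarrow> real) \<Rightarrow> real \<Rightarrow> nat \<Rightarrow> real vec \<Rightarrow> real vec" where
  "drift Abar \<nu> N v = - D1_minus N (flux_vec Abar N v) + \<nu> \<cdot>\<^sub>v D2 N v"

end

theory Submission imports Defs begin

text \<open>
  Put \<open>G a b = \<Delta>t N (Abar a b - \<nu> N (b - a))\<close>. On the cycle \<open>\<int>/N\<int>\<close> the implicit step reads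
  \<open>w\<^sub>i + G(w\<^sub>i, w\<^sub>i\<^sub>+\<^sub>1) - G(w\<^sub>i\<^sub>-\<^sub>1, w\<^sub>i) = v\<^sub>i\<close>, a conservation law whose flux \<open>G\<close> is
  nondecreasing in its first and nonincreasing in its second argument. This monotonicity of the
  flux drives both halves of the proof, and both are elementary.

  Uniqueness (\<open>monotone_flux_unique\<close>) is the discrete \<open>L\<^sup>1\<close> contraction argument: multiply the
  difference of two equations by the sign of the difference of the solutions and sum by parts over
  the cycle. Monotonicity makes the flux contribution nonnegative, hence the \<open>L\<^sup>1\<close> distance is
  nonpositive.

  Existence (\<open>monotone_flux_exists\<close>) is a Perron-type argument. Given the neighbouring values
  \<open>l\<close> and \<open>r\<close>, the equation \<open>x + G x r - G l x = c\<close> has exactly one root, since its left side is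
  continuous and strictly increasing in \<open>x\<close>; the root is nondecreasing in \<open>l\<close> and \<open>r\<close>. Constants
  solve the equation with constant data, so solving for each \<open>x\<^sub>i\<close> preserves the vectors with
  entries between \<open>min v\<close> and \<open>max v\<close>. A monotone self-map of such a box has a fixed point
  (\<open>monotone_box_fixpoint\<close>), and a fixed point solves the system.

  The sum over the cycle of either discrete divergence vanishes, so every solution inherits the
  zero sum of \<open>v\<close>.
\<close>

section \<open>Conservation equations with a monotone flux\<close>

text \<open>
  The Knaster--Tarski argument: the pointwise supremum of all \<open>w\<close> with \<open>w \<le> T w\<close> is fixed. Only
  suprema of bounded sets of reals occur, thanks to the box.
\<close>

lemma monotone_box_fixpoint:
  fixes T :: "('i \<Rightarrow> real) \<Rightarrow> 'i \<Rightarrow> real"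
  assumes "m \<le> M"
    and box: "\<And>w i. range w \<subseteq> {m..M} \<Longrightarrow> T w i \<in> {m..M}"
    and mono: "\<And>w z i. range w \<subseteq> {m..M} \<Longrightarrow> range z \<subseteq> {m..M} \<Longrightarrow> (\<And>j. w j \<le> z j) \<Longrightarrow> T w i \<le> T z i"
  shows "\<exists>u. range u \<subseteq> {m..M} \<and> (\<forall>i. T u i = u i)"
proof -
  define S where "S = {w. range w \<subseteq> {m..M} \<and> (\<forall>i. w i \<le> T w i)}"
  define u where "u i = (SUP w\<in>S. w i)" for i
  have bottom: "(\<lambda>_. m) \<in> S"
    using box[of "\<lambda>_. m"] \<open>m \<le> M\<close> by (auto simp: S_def)
  have bdd: "bdd_above ((\<lambda>w. w i) ` S)" for i
    by (rule bdd_aboveI2[where M = M]) (auto simp: S_def image_subset_iff)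
  have upper: "w i \<le> u i" if "w \<in> S" for w i
    unfolding u_def by (rule cSUP_upper[OF that bdd])
  have least: "u i \<le> c" if "\<And>w. w \<in> S \<Longrightarrow> w i \<le> c" for i c
    unfolding u_def using bottom that by (intro cSUP_least) auto
  have "u i \<in> {m..M}" for i
    using upper[OF bottom, of i] least[of i M] by (auto simp: S_def image_subset_iff)
  then have u_box: "range u \<subseteq> {m..M}" by auto
  have le: "u i \<le> T u i" for i
  proof (rule least)
    fix w assume w: "w \<in> S"
    then have "w i \<le> T w i" by (simp add: S_def)
    also have "\<dots> \<le> T u i"
      using w upper[OF w] by (intro mono u_box) (auto simp: S_def)
    finally show "w i \<le> T u i" .
  qed
  have "range (T u) \<subseteq> {m..M}"
    using box[OF u_box] by auto
  then have "T u \<in> S"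
    using le mono[OF u_box, of "T u"] by (simp add: S_def)
  then show ?thesis
    using upper le u_box by (intro exI[of _ u]) (auto intro: antisym)
qed

text \<open>
  Constant data are solved by the same constant, because the two fluxes cancel. This is what
  confines the roots at all sites to \<open>{m..M}\<close>: at an endpoint of the interval, replacing the
  neighbouring values by that endpoint moves the left side in a known direction.
\<close>

lemma monotone_flux_exists:
  fixes G :: "real \<Rightarrow> real \<Rightarrow> real" and s p :: "'i \<Rightarrow> 'i" and c :: "'i \<Rightarrow> real"
  assumes mono1: "\<And>a a' b. a \<le> a' \<Longrightarrow> G a b \<le> G a' b"
    and mono2: "\<And>a b b'. b \<le> b' \<Longrightarrow> G a b' \<le> G a b"
    and cont1: "\<And>b. continuous_on UNIV (\<lambda>a. G a b)"
    and cont2: "\<And>a. continuous_on UNIV (\<lambda>b. G a b)"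
    and c: "range c \<subseteq> {m..M}"
  shows "\<exists>w. \<forall>i. w i + G (w i) (w (s i)) - G (w (p i)) (w i) = c i"
proof -
  define H where "H l r x = x + G x r - G l x" for l r x
  have H_less: "H l' r' x' < H l r x" if "x' < x" "l \<le> l'" "r \<le> r'" for l r x l' r' x'
    using mono1[of x' x r'] mono2[of r r' x] mono1[of l l' x'] mono2[of x' x l] that
    unfolding H_def by linarith
  have c_box: "m \<le> c i" "c i \<le> M" for i
    using c by (auto simp: image_subset_iff)
  have root: "\<exists>x. m \<le> x \<and> x \<le> M \<and> H l r x = c i"
    if "l \<in> {m..M}" "r \<in> {m..M}" for l r i
  proof (rule IVT')
    show "H l r m \<le> c i" and "c i \<le> H l r M"
      using that mono1[of m l m] mono2[of m r m] mono1[of l M M] mono2[of r M M] c_box[of i]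
      by (auto simp: H_def)
    show "m \<le> M" using c_box[of i] by linarith
    show "continuous_on {m..M} (H l r)"
      unfolding H_def
      by (intro continuous_intros continuous_on_subset[OF cont1] continuous_on_subset[OF cont2]) auto
  qed
  define T where "T w i = (SOME x. m \<le> x \<and> x \<le> M \<and> H (w (p i)) (w (s i)) x = c i)" for w i
  have T: "m \<le> T w i \<and> T w i \<le> M \<and> H (w (p i)) (w (s i)) (T w i) = c i"
    if "range w \<subseteq> {m..M}" for w i
    unfolding T_def by (rule someI_ex, rule root) (use that in \<open>auto simp: image_subset_iff\<close>)
  have "\<exists>u. range u \<subseteq> {m..M} \<and> (\<forall>i. T u i = u i)"
  proof (rule monotone_box_fixpoint)
    show "m \<le> M" using c_box order_trans by blast
    show "T w i \<in> {m..M}" if "range w \<subseteq> {m..M}" for w i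
      using T[OF that] by simp
    show "T w i \<le> T z i"
      if "range w \<subseteq> {m..M}" "range z \<subseteq> {m..M}" "\<And>j. w j \<le> z j" for w z i
    proof (rule ccontr)
      assume "\<not> T w i \<le> T z i"
      then have "H (z (p i)) (z (s i)) (T z i) < H (w (p i)) (w (s i)) (T w i)"
        using that(3) by (intro H_less) auto
      then show False using T[OF that(1), of i] T[OF that(2), of i] by simp
    qed
  qed
  then obtain u where "range u \<subseteq> {m..M}" "\<And>i. T u i = u i" by blast
  then show ?thesis using T[of u] by (auto simp: H_def)
qed

text \<open>
  Summation by parts on a finite set permuted by \<open>s\<close>: both sums run over the same pairs of
  neighbours.
\<close>

lemma sum_pred_eq_sum_succ:
  fixes f :: "'i \<Rightarrow> 'i \<Rightarrow> 'b::comm_monoid_add"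
  assumes "bij_betw s I I" and "\<And>i. i \<in> I \<Longrightarrow> p (s i) = i"
  shows "(\<Sum>i\<in>I. f (p i) i) = (\<Sum>i\<in>I. f i (s i))"
proof -
  have "(\<Sum>i\<in>I. f (p i) i) = (\<Sum>i\<in>I. f (p (s i)) (s i))"
    by (rule sum.reindex_bij_betw[OF assms(1), symmetric])
  also have "\<dots> = (\<Sum>i\<in>I. f i (s i))"
    by (rule sum.cong) (simp_all add: assms(2))
  finally show ?thesis .
qed

text \<open>
  Write \<open>i+1\<close> for \<open>s i\<close>. With \<open>g\<^sub>i\<close> the difference of the fluxes of \<open>w\<close> and \<open>z\<close> from \<open>i\<close> to \<open>i+1\<close> and \<open>\<sigma>\<^sub>i\<close> the sign of \<open>w\<^sub>i - z\<^sub>i\<close>, summation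
  by parts gives \<open>\<Sum> \<bar>w\<^sub>i - z\<^sub>i\<bar> + \<Sum> g\<^sub>i (\<sigma>\<^sub>i - \<sigma>\<^sub>i\<^sub>+\<^sub>1) = 0\<close>. If \<open>\<sigma>\<^sub>i > \<sigma>\<^sub>i\<^sub>+\<^sub>1\<close> then \<open>w\<close> dominates
  \<open>z\<close> at \<open>i\<close> and is dominated by it at \<open>i+1\<close>, so \<open>g\<^sub>i \<ge> 0\<close>; the opposite case is symmetric.
\<close>

lemma monotone_flux_unique:
  fixes G :: "real \<Rightarrow> real \<Rightarrow> real" and s p :: "'i \<Rightarrow> 'i" and w z :: "'i \<Rightarrow> real"
  assumes mono1: "\<And>a a' b. a \<le> a' \<Longrightarrow> G a b \<le> G a' b"
    and mono2: "\<And>a b b'. b \<le> b' \<Longrightarrow> G a b' \<le> G a b"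
    and "finite I" and s: "bij_betw s I I" and p: "\<And>i. i \<in> I \<Longrightarrow> p (s i) = i"
    and eq: "\<And>i. i \<in> I \<Longrightarrow> w i + G (w i) (w (s i)) - G (w (p i)) (w i)
                          = z i + G (z i) (z (s i)) - G (z (p i)) (z i)"
    and "i \<in> I"
  shows "w i = z i"
proof -
  define g where "g i j = G (w i) (w j) - G (z i) (z j)" for i j
  define \<sigma> where "\<sigma> i = sgn (w i - z i)" for i
  have abs_eq: "\<bar>w i - z i\<bar> = g (p i) i * \<sigma> i - g i (s i) * \<sigma> i" if "i \<in> I" for i
  proof -
    have "w i - z i = g (p i) i - g i (s i)"
      using eq[OF that] by (simp add: g_def)
    then show ?thesis
      by (simp add: \<sigma>_def abs_sgn left_diff_distrib)
  qed
  have flux: "g i j * \<sigma> j \<le> g i j * \<sigma> i" for i j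
  proof -
    consider "\<sigma> i = \<sigma> j" | "z i \<le> w i" "w j \<le> z j" "\<sigma> j \<le> \<sigma> i" | "w i \<le> z i" "z j \<le> w j" "\<sigma> i \<le> \<sigma> j"
      unfolding \<sigma>_def
      by (cases "w i" "z i" rule: linorder_cases; cases "w j" "z j" rule: linorder_cases) auto
    then show ?thesis
    proof cases
      case 1 then show ?thesis by simp
    next
      case 2
      then have "0 \<le> g i j"
        using mono1[of "z i" "w i" "w j"] mono2[of "w j" "z j" "z i"] by (simp add: g_def)
      then show ?thesis using 2 by (intro mult_left_mono)
    next
      case 3
      then have "g i j \<le> 0"
        using mono1[of "w i" "z i" "w j"] mono2[of "z j" "w j" "z i"] by (simp add: g_def)
      then show ?thesis using 3 by (intro mult_left_mono_neg)
    qed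
  qed
  have "(\<Sum>i\<in>I. \<bar>w i - z i\<bar>) = (\<Sum>i\<in>I. g (p i) i * \<sigma> i) - (\<Sum>i\<in>I. g i (s i) * \<sigma> i)"
    by (simp add: abs_eq sum_subtractf)
  also have "(\<Sum>i\<in>I. g (p i) i * \<sigma> i) = (\<Sum>i\<in>I. g i (s i) * \<sigma> (s i))"
    by (rule sum_pred_eq_sum_succ[OF s p])
  also have "\<dots> \<le> (\<Sum>i\<in>I. g i (s i) * \<sigma> i)"
    by (intro sum_mono flux)
  finally have "(\<Sum>i\<in>I. \<bar>w i - z i\<bar>) \<le> 0" by simp
  then have "(\<Sum>i\<in>I. \<bar>w i - z i\<bar>) = 0"
    by (intro antisym sum_nonneg) auto
  then show ?thesis
    using \<open>finite I\<close> \<open>i \<in> I\<close> by (simp add: sum_nonneg_eq_0_iff)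
qed

section \<open>The cyclic grid\<close>

lemma pred_succ_mod:
  fixes i N :: nat
  assumes "i < N"
  shows "((i + 1) mod N + N - 1) mod N = i"
proof (cases "i + 1 = N")
  case False
  then have "i + 1 < N" using assms by simp
  then show ?thesis using assms by simp
qed (use assms in auto)

lemma succ_pred_mod:
  fixes i N :: nat
  assumes "i < N"
  shows "((i + N - 1) mod N + 1) mod N = i"
  using assms by (simp add: mod_simps)

lemma bij_betw_succ_mod: "bij_betw (\<lambda>i. (i + 1) mod N) {..<N} {..<N}"
  for N :: nat
  by (rule bij_betw_byWitness[where f' = "\<lambda>i. (i + N - 1) mod N"])
    (auto simp del: One_nat_def simp: pred_succ_mod succ_pred_mod)

section \<open>The implicit step\<close>

text \<open>
  The flux of the whole scheme: the viscous term is the discrete divergence of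
  \<open>\<nu> N (w\<^sub>i\<^sub>+\<^sub>1 - w\<^sub>i)\<close>, so it can be absorbed into \<open>Abar\<close> without losing monotonicity. The outer
  factor is the time step \<open>\<tau>\<close> times the \<open>N\<close> of the difference quotient.
\<close>

definition viscous_flux ::
    "(real \<Rightarrow> real \<Rightarrow> real) \<Rightarrow> real \<Rightarrow> real \<Rightarrow> nat \<Rightarrow> real \<Rightarrow> real \<Rightarrow> real" where
  "viscous_flux Abar \<nu> \<tau> N a b = \<tau> * real N * (Abar a b - \<nu> * real N * (b - a))"

lemma drift_carrier: "drift Abar \<nu> N w \<in> carrier_vec N"
  by (simp add: drift_def D2_def D1_minus_def D1_plus_def)

lemma drift_index:
  assumes "i < N"
  shows "\<tau> * drift Abar \<nu> N w $ i
    = viscous_flux Abar \<nu> \<tau> N (w $ ((i + N - 1) mod N)) (w $ i)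
      - viscous_flux Abar \<nu> \<tau> N (w $ i) (w $ ((i + 1) mod N))"
proof -
  have "(i + N - 1) mod N < N" using assms by simp
  then show ?thesis
    using assms succ_pred_mod[OF assms]
    by (simp add: drift_def D2_def D1_minus_def D1_plus_def flux_vec_def viscous_flux_def
        algebra_simps del: One_nat_def)
qed

lemma implicit_step_iff:
  assumes "v \<in> carrier_vec N" "w \<in> carrier_vec N"
  shows "w = v + \<tau> \<cdot>\<^sub>v drift Abar \<nu> N w \<longleftrightarrow>
    (\<forall>i<N. w $ i + viscous_flux Abar \<nu> \<tau> N (w $ i) (w $ ((i + 1) mod N))
            - viscous_flux Abar \<nu> \<tau> N (w $ ((i + N - 1) mod N)) (w $ i) = v $ i)"
proof -
  have "w = v + \<tau> \<cdot>\<^sub>v drift Abar \<nu> N w \<longleftrightarrow> (\<forall>i<N. w $ i = v $ i + \<tau> * drift Abar \<nu> N w $ i)"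
    using assms drift_carrier[of Abar \<nu> N w] by (auto simp: vec_eq_iff)
  also have "\<dots> \<longleftrightarrow> (\<forall>i<N. w $ i + viscous_flux Abar \<nu> \<tau> N (w $ i) (w $ ((i + 1) mod N))
            - viscous_flux Abar \<nu> \<tau> N (w $ ((i + N - 1) mod N)) (w $ i) = v $ i)"
    by (auto simp: drift_index simp del: One_nat_def)
  finally show ?thesis .
qed

lemma sum_drift_eq_0:
  "(\<Sum>i<N. \<tau> * drift Abar \<nu> N w $ i) = 0"
proof -
  define F where "F i j = viscous_flux Abar \<nu> \<tau> N (w $ i) (w $ j)" for i j
  have "(\<Sum>i<N. \<tau> * drift Abar \<nu> N w $ i)
      = (\<Sum>i<N. F ((i + N - 1) mod N) i) - (\<Sum>i<N. F i ((i + 1) mod N))"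
    by (simp add: drift_index F_def sum_subtractf del: One_nat_def)
  also have "(\<Sum>i<N. F ((i + N - 1) mod N) i) = (\<Sum>i<N. F i ((i + 1) mod N))"
    by (rule sum_pred_eq_sum_succ[where p = "\<lambda>i. (i + N - 1) mod N", OF bij_betw_succ_mod])
      (simp add: pred_succ_mod del: One_nat_def)
  finally show ?thesis by simp
qed

lemma implicit_step_zero_sum:
  assumes "v \<in> zero_sum_vec N" "w \<in> carrier_vec N" "w = v + \<tau> \<cdot>\<^sub>v drift Abar \<nu> N w"
  shows "w \<in> zero_sum_vec N"
proof -
  have "w $ i = v $ i + \<tau> * drift Abar \<nu> N w $ i" if "i < N" for i
    using arg_cong[OF assms(3), of "\<lambda>u. u $ i"] that assms(1) drift_carrier[of Abar \<nu> N w]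
    by (simp add: zero_sum_vec_def)
  then have "(\<Sum>i<N. w $ i) = (\<Sum>i<N. v $ i) + (\<Sum>i<N. \<tau> * drift Abar \<nu> N w $ i)"
    by (simp add: sum.distrib)
  then show ?thesis
    using assms(1,2) unfolding zero_sum_vec_def sum_drift_eq_0 by simp
qed

lemma C1_real2_partial_derivs:
  assumes "C1_real2 F"
  shows "((\<lambda>x. F x y) has_real_derivative partial1 F x y) (at x)"
    and "((\<lambda>y. F x y) has_real_derivative partial2 F x y) (at y)"
proof -
  have F: "(\<lambda>(v, w). F v w) differentiable at q" for q
    using assms unfolding C1_real2_def by blast
  have "((\<lambda>(v, w). F v w) \<circ> (\<lambda>x. (x, y))) differentiable at x"
    by (intro differentiable_chain_at F) (auto simp: differentiable_def intro!: derivative_eq_intros)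
  then show "((\<lambda>x. F x y) has_real_derivative partial1 F x y) (at x)"
    by (simp add: o_def partial1_def DERIV_deriv_iff_real_differentiable)
  have "((\<lambda>(v, w). F v w) \<circ> (\<lambda>y. (x, y))) differentiable at y"
    by (intro differentiable_chain_at F) (auto simp: differentiable_def intro!: derivative_eq_intros)
  then show "((\<lambda>y. F x y) has_real_derivative partial2 F x y) (at y)"
    by (simp add: o_def partial2_def DERIV_deriv_iff_real_differentiable)
qed

theorem proposition2p13:
  fixes A :: "real \<Rightarrow> real" and Abar :: "real \<Rightarrow> real \<Rightarrow> real"
    and \<nu> C_A C_Abar \<Delta>t :: real and p_A p_Abar N :: nat and v :: "real vec"
  assumes "\<nu> > 0"
    and "C2_real A"
    and "locally_lipschitz (deriv (deriv A))"
    and "C_A > 0" and "p_A \<ge> 1"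
    and "\<And>x. \<bar>deriv A x\<bar> \<le> C_A * (1 + \<bar>x\<bar> ^ p_A)"
    and "C1_real2 Abar"
    and "locally_lipschitz (\<lambda>(x, y). partial1 Abar x y)"
    and "locally_lipschitz (\<lambda>(x, y). partial2 Abar x y)"
    and "\<And>x. Abar x x = A x"
    and "\<And>x y. partial1 Abar x y \<ge> 0"
    and "\<And>x y. partial2 Abar x y \<le> 0"
    and "C_Abar > 0" and "p_Abar \<ge> 1"
    and "\<And>x y. \<bar>partial1 Abar x y\<bar> \<le> C_Abar * (1 + \<bar>x\<bar> ^ p_Abar)"
    and "\<And>x y. \<bar>partial2 Abar x y\<bar> \<le> C_Abar * (1 + \<bar>y\<bar> ^ p_Abar)"
    and "N \<ge> 1"
    and "\<Delta>t > 0"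
    and "v \<in> zero_sum_vec N"
  shows "\<exists>!w. w \<in> zero_sum_vec N \<and> w = v + \<Delta>t \<cdot>\<^sub>v drift Abar \<nu> N w"
proof -
  define G where "G = viscous_flux Abar \<nu> \<Delta>t N"
  note deriv = C1_real2_partial_derivs[OF \<open>C1_real2 Abar\<close>]
  have Abar1: "Abar a b \<le> Abar a' b" if "a \<le> a'" for a a' b
    using that deriv(1) \<open>\<And>x y. partial1 Abar x y \<ge> 0\<close>
    by (intro DERIV_nonneg_imp_nondecreasing[where f = "\<lambda>x. Abar x b"]) blast+
  have Abar2: "Abar a b' \<le> Abar a b" if "b \<le> b'" for a b b'
    using that deriv(2) \<open>\<And>x y. partial2 Abar x y \<le> 0\<close>
    by (intro DERIV_nonpos_imp_nonincreasing[where f = "\<lambda>y. Abar a y"]) blast+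
  have G1: "G a b \<le> G a' b" if "a \<le> a'" for a a' b
    using that Abar1[OF that, of b] \<open>\<nu> > 0\<close> \<open>\<Delta>t > 0\<close>
    unfolding G_def viscous_flux_def by (intro mult_left_mono diff_mono) auto
  have G2: "G a b' \<le> G a b" if "b \<le> b'" for a b b'
    using that Abar2[OF that, of a] \<open>\<nu> > 0\<close> \<open>\<Delta>t > 0\<close>
    unfolding G_def viscous_flux_def by (intro mult_left_mono diff_mono) auto
  have cont1: "continuous_on UNIV (\<lambda>a. G a b)" for b
    unfolding G_def viscous_flux_def
    by (intro continuous_intros DERIV_continuous_on[OF deriv(1)[THEN DERIV_subset]]) auto
  have cont2: "continuous_on UNIV (\<lambda>b. G a b)" for a
    unfolding G_def viscous_flux_def
    by (intro continuous_intros DERIV_continuous_on[OF deriv(2)[THEN DERIV_subset]]) auto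
  have v: "v \<in> carrier_vec N" using \<open>v \<in> zero_sum_vec N\<close> by (simp add: zero_sum_vec_def)
  (* Extending the data periodically from {0..<N} to all of nat makes the existence lemma
     applicable with the whole type as index set. *)
  define c where "c i = v $ (i mod N)" for i
  have "range c \<subseteq> (\<lambda>i. v $ i) ` {..<N}" using \<open>N \<ge> 1\<close> by (auto simp: c_def)
  then have "finite (range c)" by (rule finite_subset) simp
  then have "range c \<subseteq> {Min (range c)..Max (range c)}" by auto
  from monotone_flux_exists[OF G1 G2 cont1 cont2 this,
      of "\<lambda>i. (i + 1) mod N" "\<lambda>i. (i + N - 1) mod N"]
  obtain u where u: "\<And>i. u i + G (u i) (u ((i + 1) mod N)) - G (u ((i + N - 1) mod N)) (u i) = c i"
    by blast
  show ?thesis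
  proof (rule ex_ex1I)
    have "\<forall>i<N. vec N u $ i + G (vec N u $ i) (vec N u $ ((i + 1) mod N))
        - G (vec N u $ ((i + N - 1) mod N)) (vec N u $ i) = v $ i"
      using u by (simp add: c_def del: One_nat_def)
    then have "vec N u = v + \<Delta>t \<cdot>\<^sub>v drift Abar \<nu> N (vec N u)"
      unfolding G_def by (subst implicit_step_iff[OF v]) auto
    then show "\<exists>w. w \<in> zero_sum_vec N \<and> w = v + \<Delta>t \<cdot>\<^sub>v drift Abar \<nu> N w"
      using implicit_step_zero_sum[OF \<open>v \<in> zero_sum_vec N\<close>, of "vec N u"] by auto
  next
    fix w z
    assume w: "w \<in> zero_sum_vec N \<and> w = v + \<Delta>t \<cdot>\<^sub>v drift Abar \<nu> N w"
      and z: "z \<in> zero_sum_vec N \<and> z = v + \<Delta>t \<cdot>\<^sub>v drift Abar \<nu> N z"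
    have wc: "w \<in> carrier_vec N" and zc: "z \<in> carrier_vec N"
      using w z by (auto simp: zero_sum_vec_def)
    have w_eq: "w $ i + G (w $ i) (w $ ((i + 1) mod N)) - G (w $ ((i + N - 1) mod N)) (w $ i) = v $ i"
      if "i < N" for i
      using w that implicit_step_iff[OF v wc] unfolding G_def by blast
    have z_eq: "z $ i + G (z $ i) (z $ ((i + 1) mod N)) - G (z $ ((i + N - 1) mod N)) (z $ i) = v $ i"
      if "i < N" for i
      using z that implicit_step_iff[OF v zc] unfolding G_def by blast
    have "w $ i = z $ i" if "i < N" for i
    proof (rule monotone_flux_unique[where w = "\<lambda>i. w $ i" and z = "\<lambda>i. z $ i"
          and p = "\<lambda>i. (i + N - 1) mod N", OF G1 G2 _ bij_betw_succ_mod])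
      show "finite {..<N}" and "i \<in> {..<N}" using that by auto
      show "((j + 1) mod N + N - 1) mod N = j" if "j \<in> {..<N}" for j
        using that pred_succ_mod by blast
      show "w $ j + G (w $ j) (w $ ((j + 1) mod N)) - G (w $ ((j + N - 1) mod N)) (w $ j)
          = z $ j + G (z $ j) (z $ ((j + 1) mod N)) - G (z $ ((j + N - 1) mod N)) (z $ j)"
        if "j \<in> {..<N}" for j
        using that by (simp only: w_eq z_eq lessThan_iff)
    qed
    then show "w = z" using wc zc by (intro eq_vecI) auto
  qed
qed

end
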